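(* Let $x=(0,x_1,x_2,\dots)$ be an eventually constant time series in $\mathbb{R}^d$, and let $X=(X^a:a\in\mathfrak{A})$ be the associated infinite-dimensional path whose component $X^a$, for $a=[1^{k_1}\cdots d^{k_d}]\in\mathfrak{A}$, is the piecewise linear interpolation of the sequence $$n\mapsto\sum_{j=1}^n\Delta x_j^a=\sum_{j=1}^n(\Delta x_j^{[1]})^{k_1}\cdots(\Delta x_j^{[d]})^{k_d}.$$ Then for all $w\in T(\mathfrak{A})$, $$\langle\Phi_{\mathrm H}(w),\operatorname{ISS}(x)\rangle=\langle w,S(X)\rangle .$$
   Context: Words. $A=\{1,\dots,d\}$ is a set of $d$ letters, and $\mathfrak{A}$ is the free commutative semigroup (without unit) generated by $A$; its product is written $[ab]=[ba]$, elements are written $[a_1\cdots a_p]$, $p\ge1$, $a_i\in A$, or $[1^{k_1}\cdots d^{k_d}]$ with $k_i\ge0$ not all zero, and $[a]:=a$ for $a\in\mathfrak{A}$. $T(\mathfrak{A})$ is the tensor algebra over the real vector space with basis $\mathfrak{A}$; its basis consists of the words $w=w_1\cdots w_k$, $w_i\in\mathfrak{A}$ (also written $[w_1]\cdots[w_k]$), including the empty word $e$; $\ell(w)=k$ is the length. $\langle w,c\rangle$ denotes the value of a linear functional $c$ on $T(\mathfrak{A})$ at $w$. Hoffman's exponential. For $n\ge1$, $\mathcal{C}(n)$ is the set of compositions of $n$, i.e. tuples $I=(i_1,\dots,i_p)$ of positive integers with sum $n$. For $I\in\mathcal{C}(n)$ and a word $w=w_1\cdots w_n$, set $I[w]=[w_1\cdots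 w_{i_1}][w_{i_1+1}\cdots w_{i_1+i_2}]\cdots[w_{i_1+\cdots+i_{p-1}+1}\cdots w_n]$, a word of length $p$. $\Phi_{\mathrm H}:T(\mathfrak{A})\to T(\mathfrak{A})$ is the linear map with $\Phi_{\mathrm H}(e)=e$ and $\Phi_{\mathrm H}(w)=\sum_{(i_1,\dots,i_p)\in\mathcal{C}(\ell(w))}\frac{1}{i_1!\cdots i_p!}I[w]$ for nonempty words. Iterated-sums signature. For a time series $x=(x_0,x_1,\dots)$, $x_j=(x_j^{[1]},\dots,x_j^{[d]})$, set $\Delta x_j^{[a]}=x_j^{[a]}-x_{j-1}^{[a]}$ for $a\in A$, $j\ge1$, and $\Delta x_j^{[a_1\cdots a_p]}=\Delta x_j^{[a_1]}\cdots\Delta x_j^{[a_p]}$. $\operatorname{ISS}(x)$ is the linear functional on $T(\mathfrak{A})$ with $\langle e,\operatorname{ISS}(x)\rangle=1$ and $\langle[u_1]\cdots[u_k],\operatorname{ISS}(x)\rangle=\sum_{0<i_1<\cdots<i_k}\Delta x_{i_1}^{[u_1]}\cdots\Delta x_{i_k}^{[u_k]}$ (a finite sum since $x$ is eventually constant). Iterated-integrals signature. The interpolation is taken at the time points $0,1,\dots,N$, where $N$ is such that $x$ is constant from time $N$ on (the value at time $0$ being $0$). $S(X)$ is the linear functional on $T(\mathfrak{A})$ with $\langle e,S(X)\rangle=1$ and, for $u_1,\dots,u_k\in\mathfrak{A}$, $$\langle[u_1]\cdots[u_k],S(X)\rangle=\int_{0<t_1<\cdots<t_k<N}dX^{u_1}_{t_1}\cdots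 dX^{u_k}_{t_k}.$$ *)

theory Defs
  imports "HOL-Analysis.Analysis" "HOL-Library.Poly_Mapping" "HOL-Library.Multiset"
begin

section \<open>Extended letters, words and the tensor algebra\<close>

text \<open>
  The set of letters \<open>A\<close> is the universe of a finite type \<open>'d\<close>. The free commutative semigroup
  without unit over \<open>A\<close> consists of the nonempty multisets over \<open>A\<close>; its product is multiset sum,
  and \<open>[1^k1 ... d^kd]\<close> is the multiset in which the letter \<open>i\<close> has multiplicity \<open>ki\<close>.
\<close>

typedef 'd ext_letter = "{M :: 'd multiset. M \<noteq> {#}}"
  morphisms mset_of_letter letter_of_mset
  by (rule exI[of _ "{#undefined#}"]) simp

setup_lifting type_definition_ext_letter

instantiation ext_letter :: (type) ab_semigroup_mult
begin

lift_definition times_ext_letter :: "'a ext_letter \<Rightarrow> 'a ext_letter \<Rightarrow> 'a ext_letter"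
  is "\<lambda>M N. M + N"
  by simp

instance
  by standard (transfer, simp add: ac_simps)+

end

type_synonym 'd word = "'d ext_letter list"

text \<open>
  As a real vector space, the tensor algebra is the space of finitely supported real functions on
  words; \<open>Poly_Mapping.single w 1\<close> is the basis vector belonging to the word \<open>w\<close>.
\<close>

type_synonym 'd tensor = "'d word \<Rightarrow>\<^sub>0 real"

instantiation poly_mapping :: (type, real_vector) real_vector
begin

lift_definition scaleR_poly_mapping :: "real \<Rightarrow> ('a \<Rightarrow>\<^sub>0 'b) \<Rightarrow> ('a \<Rightarrow>\<^sub>0 'b)"
  is "\<lambda>c f k. c *\<^sub>R f k"
  by (rule finite_subset) auto

instance
  by standard (transfer, simp add: fun_eq_iff scaleR_add_left scaleR_add_right)+

end

definition linear_extension :: "('a \<Rightarrow> 'b::real_vector) \<Rightarrow> ('a \<Rightarrow>\<^sub>0 real) \<Rightarrow> 'b"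
  where "linear_extension f p =
    (\<Sum>w\<in>Poly_Mapping.keys p. Poly_Mapping.lookup p w *\<^sub>R f w)"

lemma linear_extension_single: "linear_extension f (Poly_Mapping.single w 1) = f w"
  by (simp add: linear_extension_def)

lemma linear_extension_superset:
  assumes "finite B" "Poly_Mapping.keys p \<subseteq> B"
  shows "linear_extension f p = (\<Sum>w\<in>B. Poly_Mapping.lookup p w *\<^sub>R f w)"
  unfolding linear_extension_def
  by (rule sum.mono_neutral_left) (use assms in \<open>auto simp: in_keys_iff\<close>)

lemma linear_linear_extension: "linear (linear_extension f)"
proof (rule linearI)
  fix p q :: "'a \<Rightarrow>\<^sub>0 real" and c :: real
  let ?B = "Poly_Mapping.keys p \<union> Poly_Mapping.keys q"
  have "Poly_Mapping.keys (p + q) \<subseteq> ?B"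
    by (rule Poly_Mapping.keys_add)
  then show "linear_extension f (p + q) = linear_extension f p + linear_extension f q"
    by (simp add: linear_extension_superset[of ?B] lookup_add scaleR_add_left sum.distrib)
  have "Poly_Mapping.keys (c *\<^sub>R p) \<subseteq> Poly_Mapping.keys p"
    by (auto simp: in_keys_iff scaleR_poly_mapping.rep_eq)
  then show "linear_extension f (c *\<^sub>R p) = c *\<^sub>R linear_extension f p"
    by (simp add: linear_extension_superset[of "Poly_Mapping.keys p"]
        scaleR_poly_mapping.rep_eq scaleR_sum_right)
qed


section \<open>Hoffman's exponential\<close>

definition compositions :: "nat \<Rightarrow> nat list set"
  where "compositions n = {I. (\<forall>i\<in>set I. 0 < i) \<and> sum_list I = n}"

lemma finite_compositions: "finite (compositions n)"
proof (rule finite_subset)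
  have "length I \<le> sum_list I" if "\<forall>i\<in>set I. 0 < i" for I :: "nat list"
    using that by (induction I) auto
  then show "compositions n \<subseteq> {I. set I \<subseteq> {..n} \<and> length I \<le> n}"
    by (auto simp: compositions_def member_le_sum_list)
qed (simp add: finite_lists_length_le)

text \<open>The semigroup has no unit, so the product of a list of letters makes sense only for
  nonempty lists; the blocks of a composition are never empty.\<close>

fun bracket :: "'d word \<Rightarrow> 'd ext_letter" where
  "bracket [a] = a"
| "bracket (a # b # w) = a * bracket (b # w)"

fun contract :: "nat list \<Rightarrow> 'd word \<Rightarrow> 'd word" where
  "contract [] w = []"
| "contract (i # I) w = bracket (take i w) # contract I (drop i w)"

definition hoffman_exp_word :: "'d word \<Rightarrow> 'd tensor"
  where "hoffman_exp_word w =
    (if w = [] then Poly_Mapping.single [] 1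
     else \<Sum>I\<in>compositions (length w).
            (1 / (\<Prod>i\<leftarrow>I. fact i)) *\<^sub>R Poly_Mapping.single (contract I w) 1)"

definition hoffman_exp :: "'d tensor \<Rightarrow> 'd tensor"
  where "hoffman_exp = linear_extension hoffman_exp_word"


section \<open>The iterated-sums signature\<close>

text \<open>Only used for \<open>j \<ge> 1\<close>.\<close>

definition increment :: "(nat \<Rightarrow> real ^ 'd) \<Rightarrow> nat \<Rightarrow> 'd ext_letter \<Rightarrow> real"
  where "increment x j a = (\<Prod>b\<in>#mset_of_letter a. x j $ b - x (j - 1) $ b)"

text \<open>For an eventually constant series only finitely many summands are nonzero, so the
  \<open>infsum\<close> below is then a finite sum. For the empty word the only index list is \<open>[]\<close>
  and the value is 1.\<close>

definition iss_word :: "(nat \<Rightarrow> real ^ 'd) \<Rightarrow> 'd word \<Rightarrow> real"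
  where "iss_word x w =
    (\<Sum>\<^sub>\<infinity>i\<in>{i. length i = length w \<and> sorted_wrt (<) i \<and> (\<forall>j\<in>set i. 0 < j)}.
       \<Prod>k<length w. increment x (i ! k) (w ! k))"

definition ISS :: "(nat \<Rightarrow> real ^ 'd) \<Rightarrow> 'd tensor \<Rightarrow> real"
  where "ISS x = linear_extension (iss_word x)"


section \<open>The iterated-integrals signature\<close>

text \<open>Riemann--Stieltjes integral \<open>\<integral>\<^sub>a\<^sup>b f dg\<close>: limit of the Riemann--Stieltjes sums as the mesh of the
  tagged division tends to 0. A division with every piece inside the ball of radius \<open>\<delta>\<close>
  around its tag has mesh less than \<open>2 \<delta>\<close>, and every division of mesh less than
  \<open>\<delta>\<close> is of this form.\<close>

definition has_rs_integral ::
    "(real \<Rightarrow> real) \<Rightarrow> (real \<Rightarrow> real) \<Rightarrow> real \<Rightarrow> real \<Rightarrow> real \<Rightarrow> bool"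
  where "has_rs_integral f g a b I \<longleftrightarrow>
    (\<forall>\<epsilon>>0. \<exists>\<delta>>0. \<forall>p. p tagged_division_of {a..b} \<and> (\<lambda>x. ball x \<delta>) fine p \<longrightarrow>
       \<bar>(\<Sum>(\<xi>, K)\<in>p. f \<xi> * (g (Sup K) - g (Inf K))) - I\<bar> < \<epsilon>)"

definition rs_integral :: "(real \<Rightarrow> real) \<Rightarrow> (real \<Rightarrow> real) \<Rightarrow> real \<Rightarrow> real \<Rightarrow> real"
  where "rs_integral f g a b = (THE I. has_rs_integral f g a b I)"

lemma has_rs_integral_unique:
  assumes "has_rs_integral f g a b I" "has_rs_integral f g a b J"
  shows "I = J"
proof (rule ccontr)
  assume "I \<noteq> J"
  define e where "e = \<bar>I - J\<bar> / 2"
  have "e > 0" using \<open>I \<noteq> J\<close> by (simp add: e_def)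
  define s where "s = (\<lambda>p. \<Sum>(\<xi>, K)\<in>p. f \<xi> * (g (Sup K) - g (Inf K)))"
  obtain d1 where d1: "d1 > 0"
    "\<And>p. p tagged_division_of {a..b} \<Longrightarrow> (\<lambda>x. ball x d1) fine p \<Longrightarrow> \<bar>s p - I\<bar> < e"
    using assms(1) \<open>e > 0\<close> unfolding has_rs_integral_def s_def by meson
  obtain d2 where d2: "d2 > 0"
    "\<And>p. p tagged_division_of {a..b} \<Longrightarrow> (\<lambda>x. ball x d2) fine p \<Longrightarrow> \<bar>s p - J\<bar> < e"
    using assms(2) \<open>e > 0\<close> unfolding has_rs_integral_def s_def by meson
  have "gauge (\<lambda>x::real. ball x (min d1 d2))"
    using d1(1) d2(1) by (simp add: gauge_def)
  then obtain p where p: "p tagged_division_of {a..b}" "(\<lambda>x. ball x (min d1 d2)) fine p"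
    using fine_division_exists_real by blast
  have "(\<lambda>x. ball x d1) fine p" "(\<lambda>x. ball x d2) fine p"
    using p(2) by (fastforce simp: fine_def)+
  then have "\<bar>s p - I\<bar> < e" "\<bar>s p - J\<bar> < e"
    using d1(2) d2(2) p(1) by blast+
  then have "\<bar>I - J\<bar> < 2 * e" by linarith
  then show False by (simp add: e_def)
qed

text \<open>
  The integral of \<open>dX^u1 ... dX^uk\<close> over \<open>0 < t1 < ... < tk < t\<close> is the repeated integral
  \<open>F\<^sub>0 = 1\<close>, \<open>F\<^sub>j(t) = \<integral>\<^sub>0\<^sup>t F\<^sub>j\<^sub>-\<^sub>1(s) dX^uj(s)\<close>: the first letter of the word belongs to the innermost
  integral.
\<close>

definition iterated_integral :: "('a \<Rightarrow> real \<Rightarrow> real) \<Rightarrow> 'a list \<Rightarrow> real \<Rightarrow> real"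
  where "iterated_integral X w =
    foldl (\<lambda>F u t. rs_integral F (X u) 0 t) (\<lambda>t. 1) w"

definition signature :: "real \<Rightarrow> ('d ext_letter \<Rightarrow> real \<Rightarrow> real) \<Rightarrow> 'd tensor \<Rightarrow> real"
  where "signature T X = linear_extension (\<lambda>w. iterated_integral X w T)"

text \<open>Piecewise linear interpolation at the time points \<open>0, 1, 2, ...\<close>; meaningful for
  \<open>t \<ge> 0\<close>.\<close>

definition pw_linear_interp :: "(nat \<Rightarrow> real) \<Rightarrow> real \<Rightarrow> real"
  where "pw_linear_interp f t =
    (let n = nat \<lfloor>t\<rfloor> in f n + (t - real n) * (f (Suc n) - f n))"

definition interp_path :: "(nat \<Rightarrow> real ^ 'd) \<Rightarrow> 'd ext_letter \<Rightarrow> real \<Rightarrow> real"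
  where "interp_path x a = pw_linear_interp (\<lambda>n. \<Sum>j=1..n. increment x j a)"

end

theory Submission
  imports Defs
begin

text \<open>
  Let \<open>E n w\<close> be the iterated-sums signature of \<open>x\<close> up to time \<open>n\<close>, evaluated at \<open>\<Phi>\<^sub>H(w)\<close>.
  Splitting off the last block of a composition, which may or may not sit at time \<open>n + 1\<close>, gives
  \<open>E (n + 1) w = (\<Sum>w = uv. E n u \<cdot> \<Delta>x\<^sub>n\<^sub>+\<^sub>1\<^sup>v / \<ell>(v)!)\<close>. This is Chen's identity for a path
  that is linear on \<open>[n, n + 1]\<close>; replacing \<open>\<Delta>x\<^sub>n\<^sub>+\<^sub>1\<^sup>v\<close> by \<open>s\<^bsup>\<ell>(v)\<^esup> \<Delta>x\<^sub>n\<^sub>+\<^sub>1\<^sup>v\<close> gives a continuous,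
  piecewise polynomial function of \<open>t = n + s\<close> whose derivative satisfies the recursion defining the
  iterated integrals, so the two agree.
\<close>

section \<open>Riemann--Stieltjes integrals against piecewise smooth integrators\<close>

text \<open>On a piece with tag \<open>\<xi>\<close>, the gap between the Stieltjes summand and the
  increment of \<open>H\<close> is the integral of \<open>(f \<xi> - f t) * g' t\<close>, which is
  small relative to the length of the piece because \<open>f\<close> is uniformly continuous and
  \<open>g'\<close> is bounded. The finite set \<open>S\<close> allows for kinks.\<close>

lemma has_rs_integral_antiderivative:
  fixes f g H g' :: "real \<Rightarrow> real"
  assumes "a \<le> b" and S: "finite S"
    and contf: "continuous_on {a..b} f"
    and contg: "continuous_on {a..b} g"
    and contH: "continuous_on {a..b} H"
    and g: "\<And>t. t \<in> {a<..<b} - S \<Longrightarrow> (g has_real_derivative g' t) (at t)"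
    and H: "\<And>t. t \<in> {a<..<b} - S \<Longrightarrow> (H has_real_derivative f t * g' t) (at t)"
    and C: "\<And>t. t \<in> {a<..<b} \<Longrightarrow> \<bar>g' t\<bar> \<le> C"
  shows "has_rs_integral f g a b (H b - H a)"
  unfolding has_rs_integral_def
proof (intro allI impI)
  fix \<epsilon> :: real assume "\<epsilon> > 0"
  define C' where "C' = \<bar>C\<bar> + 1"
  have C': "C' > 0" by (simp add: C'_def)
  \<comment> \<open>Makes the total error \<open>e * C' * (b - a)\<close> less than
    \<open>\<epsilon>\<close>; the added 1 covers \<open>a = b\<close>.\<close>
  define e where "e = \<epsilon> / (C' * (b - a + 1))"
  have e: "e > 0" using \<open>\<epsilon> > 0\<close> C' \<open>a \<le> b\<close> by (simp add: e_def)
  have "uniformly_continuous_on {a..b} f"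
    using contf by (simp add: compact_uniformly_continuous)
  then obtain d where d: "d > 0"
    "\<And>s \<xi>. s \<in> {a..b} \<Longrightarrow> \<xi> \<in> {a..b} \<Longrightarrow> dist s \<xi> < d \<Longrightarrow> dist (f s) (f \<xi>) < e"
    using e unfolding uniformly_continuous_on_def by metis
  have local: "\<bar>f \<xi> * (g v - g u) - (H v - H u)\<bar> \<le> e * C' * (v - u)"
    if uv: "u \<le> v" "{u..v} \<subseteq> {a..b}" "\<xi> \<in> {u..v}" "{u..v} \<subseteq> ball \<xi> d" for u v \<xi>
  proof -
    define D where "D = (\<lambda>t. H t - f \<xi> * g t)"
    \<comment> \<open>The value 0 at \<open>u\<close>, \<open>v\<close> and on \<open>S\<close> does
      not affect the integral, and it makes the bound below hold on all of \<open>{u..v}\<close>,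
      although \<open>g'\<close> is controlled only on \<open>{a<..<b}\<close>.\<close>
    define D' where "D' = (\<lambda>t. if t \<in> {u<..<v} - S then (f t - f \<xi>) * g' t else 0)"
    have "(D' has_integral (D v - D u)) {u..v}"
    proof (rule fundamental_theorem_of_calculus_interior_strong[OF S \<open>u \<le> v\<close>])
      fix t assume t: "t \<in> {u<..<v} - S"
      then have t': "t \<in> {a<..<b} - S" using uv by auto
      show "(D has_vector_derivative D' t) (at t)"
        unfolding has_real_derivative_iff_has_vector_derivative[symmetric] D_def
        using t by (auto simp: D'_def algebra_simps intro!: derivative_eq_intros g[OF t'] H[OF t'])
    next
      show "continuous_on {u..v} D"
        unfolding D_def
        by (intro continuous_intros continuous_on_subset[OF contH] continuous_on_subset[OF contg] uv)
    qed
    moreover have "norm (D' t) \<le> e * C'" if t: "t \<in> {u..v}" for t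
    proof (cases "t \<in> {u<..<v} - S")
      case True
      have "\<bar>f t - f \<xi>\<bar> \<le> e"
        using d(2)[of t \<xi>] t uv by (force simp: dist_real_def dist_commute)
      moreover have "\<bar>g' t\<bar> \<le> C'"
        using C[of t] True uv by (force simp: C'_def)
      ultimately show ?thesis
        using True e by (auto simp: D'_def abs_mult intro!: mult_mono)
    qed (use e C' in \<open>auto simp: D'_def\<close>)
    ultimately have "norm (D v - D u) \<le> e * C' * measure lborel {u..v}"
      using e C' by (intro has_integral_bound_real[of "e * C'" "{}" D']) auto
    then show ?thesis using uv(1) by (simp add: D_def algebra_simps abs_minus_commute)
  qed
  show "\<exists>\<delta>>0. \<forall>p. p tagged_division_of {a..b} \<and> (\<lambda>x. ball x \<delta>) fine p \<longrightarrow>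
       \<bar>(\<Sum>(\<xi>, K)\<in>p. f \<xi> * (g (Sup K) - g (Inf K))) - (H b - H a)\<bar> < \<epsilon>"
  proof (intro exI[of _ d] conjI allI impI d(1))
    fix p assume p: "p tagged_division_of {a..b} \<and> (\<lambda>x. ball x d) fine p"
    \<comment> \<open>\<open>H b - H a\<close> telescopes over the pieces, so the error can be
      estimated piece by piece.\<close>
    have "\<bar>(\<Sum>(\<xi>, K)\<in>p. f \<xi> * (g (Sup K) - g (Inf K))) - (H b - H a)\<bar>
        = \<bar>\<Sum>(\<xi>, K)\<in>p. f \<xi> * (g (Sup K) - g (Inf K)) - (H (Sup K) - H (Inf K))\<bar>"
      using additive_tagged_division_1[OF \<open>a \<le> b\<close>, of p H] p
      by (simp add: sum_subtractf case_prod_unfold)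
    also have "\<dots> \<le> (\<Sum>(\<xi>, K)\<in>p. e * C' * (Sup K - Inf K))"
    proof (rule order_trans[OF sum_abs], rule sum_mono, clarify)
      fix \<xi> K assume K: "(\<xi>, K) \<in> p"
      have "\<xi> \<in> K" "K \<subseteq> {a..b}" "K \<subseteq> ball \<xi> d"
        using p K by (auto simp: fine_def dest: tagged_division_ofD)
      moreover obtain u v where "K = {u..v}"
        using tagged_division_ofD(4)[OF conjunct1[OF p] K] by auto
      ultimately show "\<bar>f \<xi> * (g (Sup K) - g (Inf K)) - (H (Sup K) - H (Inf K))\<bar>
          \<le> e * C' * (Sup K - Inf K)"
        using local[of u v \<xi>] by auto
    qed
    also have "\<dots> = e * C' * (b - a)"
      using additive_tagged_division_1[OF \<open>a \<le> b\<close>, of p "\<lambda>t. e * C' * t"] p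
      by (simp add: algebra_simps)
    also have "\<dots> < e * C' * (b - a + 1)" using e C' by simp
    also have "\<dots> = \<epsilon>" using C' \<open>a \<le> b\<close> by (simp add: e_def)
    finally show "\<bar>(\<Sum>(\<xi>, K)\<in>p. f \<xi> * (g (Sup K) - g (Inf K))) - (H b - H a)\<bar> < \<epsilon>" .
  qed
qed

lemma rs_integral_eqI: "has_rs_integral f g a b I \<Longrightarrow> rs_integral f g a b = I"
  unfolding rs_integral_def using has_rs_integral_unique by blast

section \<open>Functions given piecewise on unit intervals\<close>

definition piecewise :: "(nat \<Rightarrow> real \<Rightarrow> real) \<Rightarrow> real \<Rightarrow> real"
  where "piecewise c t = c (nat \<lfloor>t\<rfloor>) (t - real (nat \<lfloor>t\<rfloor>))"

lemma piecewise_of_nat [simp]: "piecewise c (real n) = c n 0"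
  by (simp add: piecewise_def)

lemma piecewise_eq:
  assumes "real n \<le> t" "t < real (Suc n)"
  shows "piecewise c t = c n (t - real n)"
proof -
  have "nat \<lfloor>t\<rfloor> = n" using assms by linarith
  then show ?thesis by (simp add: piecewise_def)
qed

lemma continuous_on_piecewise:
  assumes cont: "\<And>n. continuous_on {0..1} (c n)"
    and match: "\<And>n. c n 1 = c (Suc n) 0"
  shows "continuous_on {0..real m} (piecewise c)"
proof (induction m)
  case (Suc m)
  have "continuous_on {real m..real (Suc m)} (\<lambda>t. c m (t - real m))"
    by (rule continuous_on_compose2[OF cont]) (auto intro!: continuous_intros)
  moreover have "c m (t - real m) = piecewise c t" if "t \<in> {real m..real (Suc m)}" for t
  \<comment> \<open>At the right endpoint the floor already selects piece \<open>Suc m\<close>;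
    \<open>match\<close> gives the agreement there.\<close>
  proof (cases "t = real (Suc m)")
    case True
    then show ?thesis using match[of m] by (simp only: piecewise_of_nat) simp
  next
    case False
    then show ?thesis using that by (subst piecewise_eq[of m]) auto
  qed
  ultimately have "continuous_on {real m..real (Suc m)} (piecewise c)"
    using continuous_on_cong[OF refl, of "{real m..real (Suc m)}"] by metis
  then have "continuous_on ({0..real m} \<union> {real m..real (Suc m)}) (piecewise c)"
    using Suc by (intro continuous_on_closed_Un) auto
  then show ?case by (simp add: ivl_disj_un_two_touch)
qed simp

lemma has_real_derivative_piecewise:
  assumes "real n < t" "t < real (Suc n)"
    and "(c n has_real_derivative D) (at (t - real n))"
  shows "(piecewise c has_real_derivative D) (at t)"
proof (rule has_field_derivative_transform_within_open)
  show "((\<lambda>s. c n (s - real n)) has_real_derivative D) (at t)"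
    using DERIV_shift[of "c n" D t "- real n"] assms(3) by simp
  show "c n (s - real n) = piecewise c s" if "s \<in> {real n<..<real (Suc n)}" for s
    using that by (subst piecewise_eq[of n]) auto
qed (use assms in auto)

section \<open>Truncated iterated sums\<close>

lemma increment_mult: "increment x j (a * b) = increment x j a * increment x j b"
  by (simp add: increment_def times_ext_letter.rep_eq)

lemma increment_bracket:
  "w \<noteq> [] \<Longrightarrow> increment x j (bracket w) = (\<Prod>a\<leftarrow>w. increment x j a)"
  by (induction w rule: bracket.induct) (simp_all add: increment_mult)

text \<open>A letter is a nonempty multiset, so the product contains a zero factor; an empty product
  would be 1.\<close>

lemma increment_eq_0:
  assumes "x j = x (j - 1)"
  shows "increment x j a = 0"
proof -
  have "mset_of_letter a \<noteq> {#}" using mset_of_letter[of a] by simp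
  then show ?thesis using assms by (simp add: increment_def nonempty_has_size)
qed

definition index_lists :: "nat \<Rightarrow> nat \<Rightarrow> nat list set"
  where "index_lists n k = {i. length i = k \<and> sorted_wrt (<) i \<and> set i \<subseteq> {1..n}}"

lemma finite_index_lists: "finite (index_lists n k)"
  by (rule finite_subset[OF _ finite_lists_length_eq[of "{1..n}" k]]) (auto simp: index_lists_def)

lemma index_lists_0_right [simp]: "index_lists n 0 = {[]}"
  by (auto simp: index_lists_def)

lemma index_lists_0_Suc [simp]: "index_lists 0 (Suc k) = {}"
  by (auto simp: index_lists_def)

text \<open>The largest index comes last. If it is \<open>Suc n\<close>, strict monotonicity keeps
  the others in \<open>{1..n}\<close>; otherwise all indices lie there.\<close>

lemma index_lists_Suc_Suc:
  "index_lists (Suc n) (Suc k) =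
    index_lists n (Suc k) \<union> (\<lambda>i. i @ [Suc n]) ` index_lists n k"
proof (intro equalityI subsetI)
  fix i assume i: "i \<in> index_lists (Suc n) (Suc k)"
  then obtain j m where j: "i = j @ [m]" by (cases i rule: rev_cases) (auto simp: index_lists_def)
  show "i \<in> index_lists n (Suc k) \<union> (\<lambda>i. i @ [Suc n]) ` index_lists n k"
  proof (cases "m = Suc n")
    case True
    then show ?thesis using i j by (fastforce simp: index_lists_def sorted_wrt_append)
  next
    case False
    then have "m \<le> n" using i j by (auto simp: index_lists_def)
    then show ?thesis using i j by (fastforce simp: index_lists_def sorted_wrt_append)
  qed
next
  fix i assume "i \<in> index_lists n (Suc k) \<union> (\<lambda>i. i @ [Suc n]) ` index_lists n k"
  then show "i \<in> index_lists (Suc n) (Suc k)"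
    by (fastforce simp: index_lists_def sorted_wrt_append)
qed

definition iss_upto :: "(nat \<Rightarrow> real ^ 'd) \<Rightarrow> nat \<Rightarrow> 'd word \<Rightarrow> real"
  where "iss_upto x n w =
    (\<Sum>i\<in>index_lists n (length w). \<Prod>k<length w. increment x (i ! k) (w ! k))"

lemma iss_upto_Nil [simp]: "iss_upto x n [] = 1"
  by (simp add: iss_upto_def)

lemma iss_upto_0: "w \<noteq> [] \<Longrightarrow> iss_upto x 0 w = 0"
  by (cases w) (simp_all add: iss_upto_def)

lemma iss_upto_Suc_snoc:
  "iss_upto x (Suc n) (w @ [a]) = iss_upto x n (w @ [a]) + iss_upto x n w * increment x (Suc n) a"
proof -
  let ?f = "\<lambda>w i. \<Prod>k<length w. increment x (i ! k) (w ! k)"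
  let ?J = "(\<lambda>i. i @ [Suc n]) ` index_lists n (length w)"
  have "index_lists n (Suc (length w)) \<inter> ?J = {}"
    by (auto simp: index_lists_def)
  then have "iss_upto x (Suc n) (w @ [a]) = iss_upto x n (w @ [a]) + sum (?f (w @ [a])) ?J"
    by (simp add: iss_upto_def index_lists_Suc_Suc sum.union_disjoint finite_index_lists)
  also have "sum (?f (w @ [a])) ?J =
      (\<Sum>i\<in>index_lists n (length w). ?f (w @ [a]) (i @ [Suc n]))"
    by (subst sum.reindex) (auto simp: inj_on_def)
  also have "\<dots> = (\<Sum>i\<in>index_lists n (length w). ?f w i * increment x (Suc n) a)"
  proof (rule sum.cong[OF refl])
    fix i assume "i \<in> index_lists n (length w)"
    then have "length i = length w" by (simp add: index_lists_def)
    then show "?f (w @ [a]) (i @ [Suc n]) = ?f w i * increment x (Suc n) a"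
      by (simp add: nth_append)
  qed
  also have "\<dots> = iss_upto x n w * increment x (Suc n) a"
    by (simp add: iss_upto_def sum_distrib_right)
  finally show ?thesis .
qed

text \<open>An index list with an entry beyond \<open>N\<close> contributes 0, since the increment
  at that entry vanishes.\<close>

lemma iss_word_eq_iss_upto:
  assumes "\<forall>n\<ge>N. x n = x N"
  shows "iss_word x w = iss_upto x N w"
proof -
  let ?f = "\<lambda>i. \<Prod>k<length w. increment x (i ! k) (w ! k)"
  have "iss_word x w = infsum ?f (index_lists N (length w))"
    unfolding iss_word_def
  proof (rule infsum_cong_neutral)
    fix i
    assume i: "i \<in> {i. length i = length w \<and> sorted_wrt (<) i \<and> (\<forall>j\<in>set i. 0 < j)} -
        index_lists N (length w)"
    then obtain j where j: "j \<in> set i" "j > N"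
      by (fastforce simp: index_lists_def Suc_le_eq not_le)
    then obtain k where k: "k < length w" "i ! k = j"
      using i by (auto simp: in_set_conv_nth)
    have "x j = x (j - 1)" using assms[rule_format, of j] assms[rule_format, of "j - 1"] j(2)
      by simp
    then have "increment x (i ! k) (w ! k) = 0" using k by (simp add: increment_eq_0)
    then show "?f i = 0" using k by (intro prod_zero) auto
  qed (auto simp: index_lists_def Suc_le_eq)
  also have "\<dots> = iss_upto x N w"
    by (simp add: iss_upto_def finite_index_lists)
  finally show ?thesis .
qed

section \<open>Hoffman's exponential of truncated iterated sums\<close>

text \<open>This is \<open>E n w\<close>, with \<open>hoffman_exp_word\<close> expanded. The empty
  word needs no separate case, as \<open>[]\<close> is the only composition of 0.\<close>

definition hoffman_iss :: "(nat \<Rightarrow> real ^ 'd) \<Rightarrow> nat \<Rightarrow> 'd word \<Rightarrow> real"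
  where "hoffman_iss x n w =
    (\<Sum>I\<in>compositions (length w). iss_upto x n (contract I w) / (\<Prod>i\<leftarrow>I. fact i))"

lemma compositions_0: "compositions 0 = {[]}"
proof -
  have "I = []" if "I \<in> compositions 0" for I
    using that by (cases I) (auto simp: compositions_def)
  then show ?thesis by (auto simp: compositions_def)
qed

text \<open>Removing the last part \<open>m - k\<close> leaves a composition of
  \<open>k < m\<close>; positivity of \<open>m\<close> ensures that a last part exists.\<close>

lemma sum_compositions_snoc:
  fixes f :: "nat list \<Rightarrow> 'a::comm_monoid_add"
  assumes "m > 0"
  shows "(\<Sum>I\<in>compositions m. f I) = (\<Sum>k<m. \<Sum>I\<in>compositions k. f (I @ [m - k]))"
proof -
  have "(\<Sum>k<m. \<Sum>I\<in>compositions k. f (I @ [m - k])) =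
      (\<Sum>(k, I)\<in>Sigma {..<m} compositions. f (I @ [m - k]))"
    by (rule sum.Sigma) (auto simp: finite_compositions)
  also have "\<dots> = (\<Sum>I\<in>compositions m. f I)"
  proof (rule sum.reindex_bij_witness[where
        i = "\<lambda>I. (sum_list (butlast I), butlast I)" and j = "\<lambda>(k, I). I @ [m - k]"])
    fix I assume I: "I \<in> compositions m"
    with assms obtain J j where J: "I = J @ [j]"
      by (cases I rule: rev_cases) (auto simp: compositions_def)
    show "(sum_list (butlast I), butlast I) \<in> Sigma {..<m} compositions"
      "(case (sum_list (butlast I), butlast I) of (k, I) \<Rightarrow> I @ [m - k]) = I"
      using I J by (auto simp: compositions_def)
  qed (auto simp: compositions_def)
  finally show ?thesis by simp
qed

lemma contract_snoc:
  "contract (I @ [j]) w =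
    contract I (take (sum_list I) w) @ [bracket (take j (drop (sum_list I) w))]"
  by (induction I arbitrary: w) (simp_all add: min_def drop_take add.commute)

lemma hoffman_iss_Nil [simp]: "hoffman_iss x n [] = 1"
  by (simp add: hoffman_iss_def compositions_0)

lemma hoffman_iss_0: "w \<noteq> [] \<Longrightarrow> hoffman_iss x 0 w = 0"
  unfolding hoffman_iss_def
proof (intro sum.neutral ballI)
  fix I assume "w \<noteq> []" "I \<in> compositions (length w)"
  then have "contract I w \<noteq> []" by (cases I) (auto simp: compositions_def)
  then show "iss_upto x 0 (contract I w) / (\<Prod>i\<leftarrow>I. fact i) = 0" by (simp add: iss_upto_0)
qed

text \<open>The summands with \<open>k < length w\<close> come from placing the last block
  \<open>drop k w\<close> at time \<open>Suc n\<close>, where the increment of a bracket factors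
  over its letters. The summand \<open>k = length w\<close>, with empty product and
  \<open>fact 0\<close>, collects the terms that avoid time \<open>Suc n\<close>.\<close>

lemma hoffman_iss_Suc:
  "hoffman_iss x (Suc n) w =
    (\<Sum>k\<le>length w. hoffman_iss x n (take k w) *
      ((\<Prod>a\<leftarrow>drop k w. increment x (Suc n) a) / fact (length w - k)))"
proof (cases "w = []")
  case False
  define m where "m = length w"
  have "m > 0" using False by (simp add: m_def)
  define F where "F = (\<lambda>I. \<Prod>i\<leftarrow>I. fact i :: real)"
  define b where "b = (\<lambda>k. bracket (drop k w))"
  have contr: "contract (I @ [m - k]) w = contract I (take k w) @ [b k]"
    if "I \<in> compositions k" for I k
    using that by (simp add: contract_snoc compositions_def b_def m_def)
  \<comment> \<open>Stated for every \<open>l\<close> because the next step expands both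
    \<open>l = n\<close> and \<open>l = Suc n\<close>.\<close>
  have expand: "hoffman_iss x l w =
      (\<Sum>k<m. \<Sum>I\<in>compositions k.
        iss_upto x l (contract I (take k w) @ [b k]) / (F I * fact (m - k)))" for l
    using \<open>m > 0\<close>
    by (simp add: hoffman_iss_def m_def[symmetric] sum_compositions_snoc contr F_def)
  have "hoffman_iss x (Suc n) w = hoffman_iss x n w +
      (\<Sum>k<m. \<Sum>I\<in>compositions k.
        iss_upto x n (contract I (take k w)) / F I * (increment x (Suc n) (b k) / fact (m - k)))"
    by (simp add: expand iss_upto_Suc_snoc add_divide_distrib sum.distrib)
  also have "(\<Sum>k<m. \<Sum>I\<in>compositions k.
        iss_upto x n (contract I (take k w)) / F I * (increment x (Suc n) (b k) / fact (m - k))) =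
      (\<Sum>k<m. hoffman_iss x n (take k w) *
        ((\<Prod>a\<leftarrow>drop k w. increment x (Suc n) a) / fact (m - k)))"
    by (intro sum.cong refl)
      (simp add: hoffman_iss_def F_def b_def m_def increment_bracket min_def sum_distrib_right sum_distrib_left
        sum_divide_distrib mult_ac)
  also have "hoffman_iss x n w + \<dots> = (\<Sum>k\<le>m. hoffman_iss x n (take k w) *
        ((\<Prod>a\<leftarrow>drop k w. increment x (Suc n) a) / fact (m - k)))"
    by (simp add: lessThan_Suc_atMost[symmetric] m_def)
  finally show ?thesis by (simp add: m_def)
qed simp

lemma ISS_hoffman_exp_word:
  assumes "\<forall>n\<ge>N. x n = x N"
  shows "ISS x (hoffman_exp_word w) = hoffman_iss x N w"
proof (cases "w = []")
  case True
  then show ?thesis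
    by (simp add: ISS_def hoffman_exp_word_def linear_extension_single
        iss_word_eq_iss_upto[OF assms])
next
  case False
  then show ?thesis
    by (simp add: ISS_def hoffman_exp_word_def hoffman_iss_def linear_extension_single
        linear_sum[OF linear_linear_extension] linear_scale[OF linear_linear_extension]
        iss_word_eq_iss_upto[OF assms])
qed

section \<open>Chen's identity on a linear piece\<close>

text \<open>Chen's formula for the path up to time \<open>n\<close> followed by the fraction
  \<open>s\<close> of the next segment: a straight segment has as signature the product of its
  increments over the factorial of the word length, and scaling by \<open>s\<close> gives the
  power.\<close>

definition chen_piece :: "(nat \<Rightarrow> real ^ 'd) \<Rightarrow> 'd word \<Rightarrow> nat \<Rightarrow> real \<Rightarrow> real"
  where "chen_piece x w n s =
    (\<Sum>k\<le>length w. hoffman_iss x n (take k w) *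
      ((\<Prod>a\<leftarrow>drop k w. increment x (Suc n) a) / fact (length w - k)) * s ^ (length w - k))"

lemma chen_piece_0: "chen_piece x w n 0 = hoffman_iss x n w"
proof -
  \<comment> \<open>Only \<open>k = length w\<close> survives, through
    \<open>0 ^ 0 = 1\<close>.\<close>
  have "chen_piece x w n 0 = (\<Sum>k\<le>length w. if k = length w then hoffman_iss x n w else 0)"
    unfolding chen_piece_def by (intro sum.cong) auto
  then show ?thesis by simp
qed

lemma chen_piece_1: "chen_piece x w n 1 = hoffman_iss x (Suc n) w"
  by (simp add: chen_piece_def hoffman_iss_Suc)

text \<open>The term with empty suffix is constant. In every other term the suffix ends in
  \<open>u\<close>, whose increment factors out, and the exponent cancels the leading factor of the
  factorial.\<close>

lemma has_real_derivative_chen_piece: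
  "(chen_piece x (w @ [u]) n has_real_derivative chen_piece x w n s * increment x (Suc n) u) (at s)"
proof -
  define m where "m = length w"
  define c where "c = (\<lambda>k. hoffman_iss x n (take k w) * (\<Prod>a\<leftarrow>drop k w. increment x (Suc n) a))"
  have eq: "chen_piece x (w @ [u]) n = (\<lambda>s. hoffman_iss x n (w @ [u]) +
      (\<Sum>k\<le>m. c k * increment x (Suc n) u / fact (Suc (m - k)) * s ^ Suc (m - k)))"
    by (auto simp: chen_piece_def m_def[symmetric] c_def Suc_diff_le fun_eq_iff intro!: sum.cong)
  have "(chen_piece x (w @ [u]) n has_real_derivative
      (\<Sum>k\<le>m. c k * increment x (Suc n) u / fact (Suc (m - k)) * (real (Suc (m - k)) * s ^ (m - k))))
      (at s)"
    unfolding eq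
    by (rule derivative_eq_intros refl | simp)+ (simp add: mult_ac)
  also have "(\<Sum>k\<le>m. c k * increment x (Suc n) u / fact (Suc (m - k)) *
      (real (Suc (m - k)) * s ^ (m - k))) = chen_piece x w n s * increment x (Suc n) u"
    unfolding chen_piece_def sum_distrib_right m_def[symmetric]
    by (intro sum.cong refl) (simp add: c_def fact_Suc mult_ac del: of_nat_Suc)
  finally show ?thesis .
qed

text \<open>The pieces are polynomials, and their matching at integers is the recursion
  \<open>hoffman_iss_Suc\<close>.\<close>

lemma continuous_on_chen: "continuous_on {0..real m} (piecewise (chen_piece x w))"
proof (rule continuous_on_piecewise)
  show "continuous_on {0..1} (chen_piece x w n)" for n
    by (auto simp: chen_piece_def[abs_def] intro!: continuous_intros)
qed (simp add: chen_piece_0 chen_piece_1)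

lemma interp_path_eq_piecewise:
  "interp_path x a =
    piecewise (\<lambda>n s. (\<Sum>j=1..n. increment x j a) + s * increment x (Suc n) a)"
  by (simp add: fun_eq_iff interp_path_def pw_linear_interp_def piecewise_def Let_def)

lemma continuous_on_interp_path: "continuous_on {0..real m} (interp_path x a)"
  unfolding interp_path_eq_piecewise
  by (rule continuous_on_piecewise) (auto intro!: continuous_intros)

text \<open>The last letter is the outermost integration, hence induction from the end of the word:
  the candidate for \<open>w @ [u]\<close> is an antiderivative in the sense of
  \<open>has_rs_integral_antiderivative\<close>.\<close>

lemma iterated_integral_interp_path:
  assumes "t \<ge> 0"
  shows "iterated_integral (interp_path x) w t = piecewise (chen_piece x w) t"
  using assms
proof (induction w arbitrary: t rule: rev_induct)
  case Nil
  then show ?case by (simp add: iterated_integral_def piecewise_def chen_piece_def)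
next
  case (snoc u w)
  define m where "m = nat \<lceil>t\<rceil>"
  have m: "t \<le> real m" by (simp add: m_def real_nat_ceiling_ge)
  let ?F = "iterated_integral (interp_path x) w"
  let ?H = "piecewise (chen_piece x (w @ [u]))"
  \<comment> \<open>The slope of the piece to the right of \<open>s\<close>; it is the derivative of
    the path off the integers, which form the exceptional set.\<close>
  define g' where "g' = (\<lambda>s::real. increment x (Suc (nat \<lfloor>s\<rfloor>)) u)"
  have "has_rs_integral ?F (interp_path x u) 0 t (?H t - ?H 0)"
  proof (rule has_rs_integral_antiderivative)
    show "finite (real ` {..m})" by simp
    have sub: "{0..t} \<subseteq> {0..real m}" using m by auto
    have "continuous_on {0..t} (piecewise (chen_piece x w))"
      using continuous_on_subset[OF continuous_on_chen sub] .
    then show "continuous_on {0..t} ?F"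
      using snoc.IH by (subst continuous_on_cong[OF refl]) auto
    show "continuous_on {0..t} (interp_path x u)" "continuous_on {0..t} ?H"
      using continuous_on_subset[OF continuous_on_interp_path sub]
        continuous_on_subset[OF continuous_on_chen sub] by auto
  next
    fix s assume s: "s \<in> {0<..<t} - real ` {..m}"
    define n where "n = nat \<lfloor>s\<rfloor>"
    have "real n \<le> s" "s < real (Suc n)" using s by (auto simp: n_def) linarith+
    moreover have "n \<le> m" using s m \<open>real n \<le> s\<close> by simp
    then have "s \<noteq> real n" using s by auto
    ultimately have n: "real n < s" "s < real (Suc n)" by auto
    have g': "g' s = increment x (Suc n) u" by (simp add: g'_def n_def)
    show "(interp_path x u has_real_derivative g' s) (at s)"
      unfolding interp_path_eq_piecewise g'
      by (rule has_real_derivative_piecewise[OF n]) (auto intro!: derivative_eq_intros)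
    have "?F s = chen_piece x w n (s - real n)"
      using s n snoc.IH[of s] by (simp add: piecewise_eq)
    then show "(?H has_real_derivative ?F s * g' s) (at s)"
      unfolding g' by (simp add: has_real_derivative_piecewise[OF n] has_real_derivative_chen_piece)
  next
    fix s assume s: "s \<in> {0<..<t}"
    then have "nat \<lfloor>s\<rfloor> \<le> m" using m by (auto simp: m_def) linarith
    \<comment> \<open>Only finitely many slopes occur on \<open>{0<..<t}\<close>, so the sum of
      their absolute values is a uniform bound.\<close>
    then show "\<bar>g' s\<bar> \<le> (\<Sum>n\<le>m. \<bar>increment x (Suc n) u\<bar>)"
      unfolding g'_def by (intro member_le_sum) auto
  qed (use snoc.prems in simp)
  \<comment> \<open>A nonempty word has no iterated sums up to time 0.\<close>
  moreover have "?H 0 = 0"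
    using piecewise_of_nat[of "chen_piece x (w @ [u])" 0] by (simp add: chen_piece_0 hoffman_iss_0)
  ultimately have "rs_integral ?F (interp_path x u) 0 t = ?H t"
    by (simp add: rs_integral_eqI)
  then show ?case by (simp add: iterated_integral_def)
qed

theorem theorem5p3:
  fixes x :: "nat \<Rightarrow> real ^ 'd" and N :: nat and w :: "'d tensor"
  assumes "x 0 = 0"
    and "\<forall>n\<ge>N. x n = x N"
  shows "ISS x (hoffman_exp w) = signature (real N) (interp_path x) w"
proof -
  have lin: "linear (ISS x)"
    unfolding ISS_def[abs_def] by (rule linear_linear_extension)
  \<comment> \<open>The integer time \<open>N\<close> starts piece \<open>N\<close>, so the
    piecewise function is evaluated at offset 0 and \<open>chen_piece_0\<close> applies.\<close>
  have "ISS x (hoffman_exp_word v) = iterated_integral (interp_path x) v (real N)" for v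
    by (simp add: ISS_hoffman_exp_word[OF assms(2)] iterated_integral_interp_path chen_piece_0)
  then show ?thesis
    by (simp add: hoffman_exp_def signature_def linear_extension_def linear_sum[OF lin]
        linear_scale[OF lin])
qed

end
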